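(* Let $\Omega,\Theta,\Pi$ be measurable spaces, let $P=(P_\theta\mid\theta\in\Theta)$ be a statistical model on $\Omega$ with parameter space $\Theta$, and let $Q=(Q_\pi\mid\pi\in\Pi)$ be a statistical model on $\Theta$ with parameter space $\Pi$ (so that $(P,Q)$ is a para-Bayesian model). Let $T=(T_\pi\mid\pi\in\Pi)$ be the joint statistical model on $\Omega\times\Theta$, determined by $$T_\pi(A\times B)=\int_B P_\theta(A)\,Q_\pi(\mathrm{d}\theta)$$ for all measurable $A\subseteq\Omega$ and $B\subseteq\Theta$. Then $$\mathcal{E}_T=\bar{\mathcal{E}}_P\,\mathcal{E}_Q .$$
   Context: A statistical model $P=(P_\theta\mid\theta\in\Theta)$ on a measurable space $\Omega$ with parameter space a measurable space $\Theta$ is a Markov kernel with source $\Theta$ and target $\Omega$: each $P_\theta$ is a probability measure on $\Omega$, and for each measurable $A\subseteq\Omega$ the function $\theta\mapsto P_\theta(A)$ is measurable. An e-function with respect to a statistical model $R=(R_\alpha\mid\alpha\in\mathcal{A})$ on a measurable space $X$ is a measurable function $f:X\to[0,\infty]$ such that $\int f\,\mathrm{d}R_\alpha\le 1$ for all $\alpha\in\mathcal{A}$. The class of all of them is denoted $\mathcal{E}_R$. Thus $\mathcal{E}_Q$ consists of functions on $\Theta$ and $\mathcal{E}_T$ of functions on $\Omega\times\Theta$. $\bar{\mathcal{E}}_P$ is the class of all conditional e-functions with respect to $P$, i.e., measurable functions $g:\Omega\times\Theta\to[0,\infty]$ such that $\int_\Omega g(\omega;\theta)\,P_\theta(\mathrm{d}\omega)\le1$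 for all $\theta\in\Theta$. The product $\bar{\mathcal{E}}_P\mathcal{E}_Q$ is the class of all measurable functions $f:\Omega\times\Theta\to[0,\infty]$ such that, for some $g\in\bar{\mathcal{E}}_P$ and $h\in\mathcal{E}_Q$, for all $\pi\in\Pi$ the equality $f(\omega,\theta)=g(\omega;\theta)h(\theta)$ holds $T_\pi$-almost surely. The usual convention $0\cdot\infty=0$ is used. *)

theory Defs
  imports "HOL-Probability.Probability"
begin

text \<open>
  A measurable space is represented by a value of type \<^typ>\<open>'a measure\<close> of which only the
  carrier and the \<open>\<sigma>\<close>-algebra are used. Functions are total on the underlying type;
  their values outside the carrier are irrelevant to all notions below.
\<close>

definition statistical_model ::
    "'p measure \<Rightarrow> 'x measure \<Rightarrow> ('p \<Rightarrow> 'x measure) \<Rightarrow> bool" where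
  "statistical_model \<A> X R \<longleftrightarrow> R \<in> \<A> \<rightarrow>\<^sub>M prob_algebra X"

lemma statistical_model_iff:
  "statistical_model \<A> X R \<longleftrightarrow>
     (\<forall>\<alpha>\<in>space \<A>. prob_space (R \<alpha>) \<and> sets (R \<alpha>) = sets X) \<and>
     (\<forall>A\<in>sets X. (\<lambda>\<alpha>. emeasure (R \<alpha>) A) \<in> borel_measurable \<A>)"
proof (intro iffI conjI ballI)
  assume "statistical_model \<A> X R"
  then have R: "R \<in> \<A> \<rightarrow>\<^sub>M prob_algebra X"
    by (simp add: statistical_model_def)
  show "prob_space (R \<alpha>)" "sets (R \<alpha>) = sets X" if "\<alpha> \<in> space \<A>" for \<alpha>
    using measurable_space[OF R that] by (simp_all add: space_prob_algebra)
  show "(\<lambda>\<alpha>. emeasure (R \<alpha>) A) \<in> borel_measurable \<A>" if "A \<in> sets X" for A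
    using measurable_emeasure_kernel[OF measurable_prob_algebraD[OF R] that] .
next
  assume "(\<forall>\<alpha>\<in>space \<A>. prob_space (R \<alpha>) \<and> sets (R \<alpha>) = sets X) \<and>
    (\<forall>A\<in>sets X. (\<lambda>\<alpha>. emeasure (R \<alpha>) A) \<in> borel_measurable \<A>)"
  then show "statistical_model \<A> X R"
    unfolding statistical_model_def
    by (auto intro!: measurable_prob_algebraI measurable_subprob_algebra
        intro: prob_space_imp_subprob_space)
qed

definition e_functions ::
    "'p measure \<Rightarrow> 'x measure \<Rightarrow> ('p \<Rightarrow> 'x measure) \<Rightarrow> ('x \<Rightarrow> ennreal) set" where
  "e_functions \<A> X R =
     {f \<in> borel_measurable X. \<forall>\<alpha>\<in>space \<A>. (\<integral>\<^sup>+ x. f x \<partial>R \<alpha>) \<le> 1}"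

definition conditional_e_functions ::
    "'t measure \<Rightarrow> 'w measure \<Rightarrow> ('t \<Rightarrow> 'w measure) \<Rightarrow> ('w \<times> 't \<Rightarrow> ennreal) set" where
  "conditional_e_functions \<Theta> \<Omega> P =
     {g \<in> borel_measurable (\<Omega> \<Otimes>\<^sub>M \<Theta>).
        \<forall>\<theta>\<in>space \<Theta>. (\<integral>\<^sup>+ \<omega>. g (\<omega>, \<theta>) \<partial>P \<theta>) \<le> 1}"

text \<open>Multiplication on \<^typ>\<open>ennreal\<close> satisfies \<open>0 * \<infinity> = 0\<close>.\<close>

definition e_product ::
    "'p measure \<Rightarrow> 't measure \<Rightarrow> 'w measure \<Rightarrow> ('p \<Rightarrow> ('w \<times> 't) measure) \<Rightarrow>
     ('w \<times> 't \<Rightarrow> ennreal) set \<Rightarrow> ('t \<Rightarrow> ennreal) set \<Rightarrow> ('w \<times> 't \<Rightarrow> ennreal) set" where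
  "e_product \<Xi> \<Theta> \<Omega> T G H =
     {f \<in> borel_measurable (\<Omega> \<Otimes>\<^sub>M \<Theta>).
        \<exists>g\<in>G. \<exists>h\<in>H. \<forall>\<pi>\<in>space \<Xi>. AE (\<omega>, \<theta>) in T \<pi>. f (\<omega>, \<theta>) = g (\<omega>, \<theta>) * h \<theta>}"

definition joint_model ::
    "'p measure \<Rightarrow> 't measure \<Rightarrow> 'w measure \<Rightarrow> ('t \<Rightarrow> 'w measure) \<Rightarrow> ('p \<Rightarrow> 't measure) \<Rightarrow>
     ('p \<Rightarrow> ('w \<times> 't) measure) \<Rightarrow> bool" where
  "joint_model \<Xi> \<Theta> \<Omega> P Q T \<longleftrightarrow>
     statistical_model \<Xi> (\<Omega> \<Otimes>\<^sub>M \<Theta>) T \<and>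
     (\<forall>\<pi>\<in>space \<Xi>. \<forall>A\<in>sets \<Omega>. \<forall>B\<in>sets \<Theta>.
        emeasure (T \<pi>) (A \<times> B) = (\<integral>\<^sup>+ \<theta>\<in>B. emeasure (P \<theta>) A \<partial>Q \<pi>))"

text \<open>The joint model exists and is determined by its values on measurable rectangles.\<close>

lemma joint_model_exists:
  assumes "statistical_model \<Theta> \<Omega> P" and "statistical_model \<Xi> \<Theta> Q"
  shows "\<exists>T. joint_model \<Xi> \<Theta> \<Omega> P Q T"
proof -
  have P [measurable]: "P \<in> \<Theta> \<rightarrow>\<^sub>M prob_algebra \<Omega>" and Q [measurable]: "Q \<in> \<Xi> \<rightarrow>\<^sub>M prob_algebra \<Theta>"
    using assms by (simp_all add: statistical_model_def)
  define K where "K \<theta> = P \<theta> \<bind> (\<lambda>\<omega>. return (\<Omega> \<Otimes>\<^sub>M \<Theta>) (\<omega>, \<theta>))" for \<theta>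
  have K [measurable]: "K \<in> \<Theta> \<rightarrow>\<^sub>M prob_algebra (\<Omega> \<Otimes>\<^sub>M \<Theta>)"
    unfolding K_def by measurable
  have K_rect: "emeasure (K \<theta>) (A \<times> B) = emeasure (P \<theta>) A * indicator B \<theta>"
    if "\<theta> \<in> space \<Theta>" and A: "A \<in> sets \<Omega>" and B: "B \<in> sets \<Theta>" for \<theta> A B
  proof -
    have P\<theta>: "P \<theta> \<in> space (prob_algebra \<Omega>)"
      using measurable_space[OF P that(1)] .
    then have sets_P: "sets (P \<theta>) = sets \<Omega>"
      by (simp add: space_prob_algebra)
    have "emeasure (K \<theta>) (A \<times> B) =
        (\<integral>\<^sup>+ \<omega>. emeasure (return (\<Omega> \<Otimes>\<^sub>M \<Theta>) (\<omega>, \<theta>)) (A \<times> B) \<partial>P \<theta>)"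
      unfolding K_def
    proof (rule emeasure_bind_prob_algebra[OF P\<theta>])
      show "(\<lambda>\<omega>. return (\<Omega> \<Otimes>\<^sub>M \<Theta>) (\<omega>, \<theta>)) \<in> \<Omega> \<rightarrow>\<^sub>M prob_algebra (\<Omega> \<Otimes>\<^sub>M \<Theta>)"
        using that(1) by measurable
      show "A \<times> B \<in> sets (\<Omega> \<Otimes>\<^sub>M \<Theta>)"
        using A B by simp
    qed
    also have "\<dots> = (\<integral>\<^sup>+ \<omega>. indicator B \<theta> * indicator A \<omega> \<partial>P \<theta>)"
      using A B by (intro nn_integral_cong) (auto simp: indicator_def)
    also have "\<dots> = emeasure (P \<theta>) A * indicator B \<theta>"
      using A sets_P by (simp add: nn_integral_cmult mult.commute)
    finally show ?thesis .
  qed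
  have "joint_model \<Xi> \<Theta> \<Omega> P Q (\<lambda>\<pi>. Q \<pi> \<bind> K)"
    unfolding joint_model_def statistical_model_def
  proof (intro conjI ballI)
    show "(\<lambda>\<pi>. Q \<pi> \<bind> K) \<in> \<Xi> \<rightarrow>\<^sub>M prob_algebra (\<Omega> \<Otimes>\<^sub>M \<Theta>)"
      by measurable
    fix \<pi> A B assume \<pi>: "\<pi> \<in> space \<Xi>" and A: "A \<in> sets \<Omega>" and B: "B \<in> sets \<Theta>"
    have Q\<pi>: "Q \<pi> \<in> space (prob_algebra \<Theta>)"
      using measurable_space[OF Q \<pi>] .
    then have "space (Q \<pi>) = space \<Theta>"
      by (auto simp: space_prob_algebra dest: sets_eq_imp_space_eq)
    then show "emeasure (Q \<pi> \<bind> K) (A \<times> B) = (\<integral>\<^sup>+ \<theta>\<in>B. emeasure (P \<theta>) A \<partial>Q \<pi>)"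
      using A B by (subst emeasure_bind_prob_algebra[OF Q\<pi> K])
        (auto intro!: nn_integral_cong simp: K_rect)
  qed
  then show ?thesis by blast
qed

lemma joint_model_unique:
  assumes "joint_model \<Xi> \<Theta> \<Omega> P Q T" and "joint_model \<Xi> \<Theta> \<Omega> P Q T'" and \<pi>: "\<pi> \<in> space \<Xi>"
  shows "T \<pi> = T' \<pi>"
proof -
  let ?E = "{A \<times> B |A B. A \<in> sets \<Omega> \<and> B \<in> sets \<Theta>}"
  have T: "prob_space (T \<pi>)" "sets (T \<pi>) = sets (\<Omega> \<Otimes>\<^sub>M \<Theta>)" "sets (T' \<pi>) = sets (\<Omega> \<Otimes>\<^sub>M \<Theta>)"
    using assms by (auto simp: joint_model_def statistical_model_iff)
  show ?thesis
  proof (rule measure_eqI_generator_eq[where E = ?E and A = "\<lambda>_. space \<Omega> \<times> space \<Theta>"])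
    show "Int_stable ?E"
      by (rule Int_stable_pair_measure_generator)
    show "?E \<subseteq> Pow (space \<Omega> \<times> space \<Theta>)"
      by (auto dest: sets.sets_into_space)
    show "emeasure (T \<pi>) X = emeasure (T' \<pi>) X" if "X \<in> ?E" for X
      using that assms by (auto simp: joint_model_def)
    show "emeasure (T \<pi>) (space \<Omega> \<times> space \<Theta>) \<noteq> \<infinity>"
      using finite_measure.emeasure_finite[OF prob_space.finite_measure[OF T(1)]] by simp
  qed (use T in \<open>auto simp: sets_pair_measure\<close>)
qed

end

theory Submission
  imports Defs
begin

text \<open>
  The joint model is a two-stage experiment: \<open>\<theta>\<close> is drawn from \<open>Q\<^sub>\<pi>\<close> and then \<open>\<omega>\<close> from
  \<open>P\<^sub>\<theta>\<close>. Hence \<open>T\<^sub>\<pi>\<close>-integrals are iterated integrals (\<open>nn_integral_joint_model\<close>), and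
  \<open>T\<^sub>\<pi>\<close>-almost sure properties are those that hold \<open>P\<^sub>\<theta>\<close>-almost surely for \<open>Q\<^sub>\<pi>\<close>-almost
  all \<open>\<theta>\<close> (\<open>AE_joint_model\<close>).

  For a product \<open>g h\<close> the factor \<open>h \<theta>\<close> comes out of the inner integral, which leaves
  at most \<open>\<integral> h dQ\<^sub>\<pi> \<le> 1\<close>. Conversely, an e-function \<open>f\<close> is factored through its inner integral
  \<open>h \<theta> = \<integral> f (\<omega>, \<theta>) P\<^sub>\<theta>(d\<omega>)\<close>, with \<open>g = f / h\<close>. By the iterated integral formula \<open>h\<close> is
  an e-function for \<open>Q\<close>, and \<open>g\<close> integrates to \<open>h \<theta> / h \<theta> \<le> 1\<close> under \<open>P\<^sub>\<theta>\<close>.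
  The identity \<open>f = g h\<close> is immediate where \<open>0 < h \<theta> < \<infinity>\<close>. Where \<open>h \<theta> = 0\<close>, it holds
  \<open>P\<^sub>\<theta>\<close>-almost surely since \<open>f\<close> itself vanishes there, and \<open>h \<theta> = \<infinity>\<close> is
  a \<open>Q\<^sub>\<pi>\<close>-null event for every \<open>\<pi>\<close> since \<open>h\<close> has a finite integral.
\<close>

text \<open>
  The law of \<open>(\<omega>, \<theta>)\<close> for fixed \<open>\<theta>\<close>, that is \<open>P\<^sub>\<theta> \<otimes> \<delta>\<^sub>\<theta>\<close>. It is written as a monadic
  composition so that measurability in \<open>\<theta>\<close> follows from that of \<open>P\<close>.
\<close>

definition joint_kernel :: "'t measure \<Rightarrow> 'w measure \<Rightarrow> ('t \<Rightarrow> 'w measure) \<Rightarrow> 't \<Rightarrow> ('w \<times> 't) measure"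
  where "joint_kernel \<Theta> \<Omega> P \<theta> = P \<theta> \<bind> (\<lambda>\<omega>. return (\<Omega> \<Otimes>\<^sub>M \<Theta>) (\<omega>, \<theta>))"

lemma measurable_joint_kernel:
  assumes "statistical_model \<Theta> \<Omega> P"
  shows "joint_kernel \<Theta> \<Omega> P \<in> \<Theta> \<rightarrow>\<^sub>M prob_algebra (\<Omega> \<Otimes>\<^sub>M \<Theta>)"
proof -
  have [measurable]: "P \<in> \<Theta> \<rightarrow>\<^sub>M prob_algebra \<Omega>"
    using assms by (simp add: statistical_model_def)
  show ?thesis
    unfolding joint_kernel_def by measurable
qed

lemma statistical_model_spaces:
  assumes "statistical_model \<A> X R" and "\<alpha> \<in> space \<A>"
  shows "sets (R \<alpha>) = sets X" and "space (R \<alpha>) = space X"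
  using assms by (auto simp: statistical_model_iff dest: sets_eq_imp_space_eq)

lemma measurable_return_pair:
  assumes "statistical_model \<Theta> \<Omega> P" and "\<theta> \<in> space \<Theta>"
  shows "(\<lambda>\<omega>. return (\<Omega> \<Otimes>\<^sub>M \<Theta>) (\<omega>, \<theta>)) \<in> P \<theta> \<rightarrow>\<^sub>M subprob_algebra (\<Omega> \<Otimes>\<^sub>M \<Theta>)"
proof -
  have "(\<lambda>\<omega>. return (\<Omega> \<Otimes>\<^sub>M \<Theta>) (\<omega>, \<theta>)) \<in> \<Omega> \<rightarrow>\<^sub>M subprob_algebra (\<Omega> \<Otimes>\<^sub>M \<Theta>)"
    using assms(2) by measurable
  then show ?thesis
    using statistical_model_spaces(1)[OF assms] by (simp cong: measurable_cong_sets)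
qed

lemma nn_integral_joint_kernel:
  assumes "statistical_model \<Theta> \<Omega> P" and "\<theta> \<in> space \<Theta>"
    and "f \<in> borel_measurable (\<Omega> \<Otimes>\<^sub>M \<Theta>)"
  shows "(\<integral>\<^sup>+ z. f z \<partial>joint_kernel \<Theta> \<Omega> P \<theta>) = (\<integral>\<^sup>+ \<omega>. f (\<omega>, \<theta>) \<partial>P \<theta>)"
  unfolding joint_kernel_def
  using assms statistical_model_spaces(2)[OF assms(1,2)]
  by (subst nn_integral_bind[OF _ measurable_return_pair])
     (auto intro!: nn_integral_cong nn_integral_return simp: space_pair_measure)

lemma AE_joint_kernel:
  assumes "statistical_model \<Theta> \<Omega> P" and "\<theta> \<in> space \<Theta>"
    and "Measurable.pred (\<Omega> \<Otimes>\<^sub>M \<Theta>) R"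
  shows "(AE z in joint_kernel \<Theta> \<Omega> P \<theta>. R z) \<longleftrightarrow> (AE \<omega> in P \<theta>. R (\<omega>, \<theta>))"
  unfolding joint_kernel_def
  using assms statistical_model_spaces(2)[OF assms(1,2)]
  by (subst AE_bind[OF measurable_return_pair])
     (auto intro!: AE_cong simp: AE_return space_pair_measure)

text \<open>
  A joint model is specified only by its values on rectangles. This identification with a
  composition of kernels gives access to integrals and null sets. Since rectangles
  determine a joint model, it suffices to evaluate the composition on them.
\<close>

lemma joint_model_eq_bind:
  assumes P: "statistical_model \<Theta> \<Omega> P" and Q: "statistical_model \<Xi> \<Theta> Q"
    and T: "joint_model \<Xi> \<Theta> \<Omega> P Q T" and \<pi>: "\<pi> \<in> space \<Xi>"
  shows "T \<pi> = Q \<pi> \<bind> joint_kernel \<Theta> \<Omega> P"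
proof (rule joint_model_unique[OF T _ \<pi>])
  note [measurable] = measurable_joint_kernel[OF P]
  have Qm [measurable]: "Q \<in> \<Xi> \<rightarrow>\<^sub>M prob_algebra \<Theta>"
    using Q by (simp add: statistical_model_def)
  show "joint_model \<Xi> \<Theta> \<Omega> P Q (\<lambda>\<pi>. Q \<pi> \<bind> joint_kernel \<Theta> \<Omega> P)"
    unfolding joint_model_def
  proof (intro conjI ballI)
    show "statistical_model \<Xi> (\<Omega> \<Otimes>\<^sub>M \<Theta>) (\<lambda>\<pi>. Q \<pi> \<bind> joint_kernel \<Theta> \<Omega> P)"
      unfolding statistical_model_def by measurable
    fix \<rho> A B assume \<rho>: "\<rho> \<in> space \<Xi>" and A: "A \<in> sets \<Omega>" and B: "B \<in> sets \<Theta>"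
    have rectangle: "emeasure (joint_kernel \<Theta> \<Omega> P \<theta>) (A \<times> B) = emeasure (P \<theta>) A * indicator B \<theta>"
      if \<theta>: "\<theta> \<in> space \<Theta>" for \<theta>
    proof -
      have "A \<times> B \<in> sets (joint_kernel \<Theta> \<Omega> P \<theta>)"
        using measurable_space[OF measurable_joint_kernel[OF P] \<theta>] A B
        by (simp add: space_prob_algebra)
      then have "emeasure (joint_kernel \<Theta> \<Omega> P \<theta>) (A \<times> B) =
          (\<integral>\<^sup>+ z. indicator (A \<times> B) z \<partial>joint_kernel \<Theta> \<Omega> P \<theta>)"
        by simp
      also have "\<dots> = (\<integral>\<^sup>+ \<omega>. indicator (A \<times> B) (\<omega>, \<theta>) \<partial>P \<theta>)"
        using A B by (intro nn_integral_joint_kernel[OF P \<theta>]) simp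
      also have "\<dots> = (\<integral>\<^sup>+ \<omega>. indicator B \<theta> * indicator A \<omega> \<partial>P \<theta>)"
        by (intro nn_integral_cong) (auto simp: indicator_def)
      also have "\<dots> = emeasure (P \<theta>) A * indicator B \<theta>"
        using A statistical_model_spaces(1)[OF P \<theta>]
        by (simp add: nn_integral_cmult mult.commute)
      finally show ?thesis .
    qed
    show "emeasure (Q \<rho> \<bind> joint_kernel \<Theta> \<Omega> P) (A \<times> B) = (\<integral>\<^sup>+ \<theta>\<in>B. emeasure (P \<theta>) A \<partial>Q \<rho>)"
      using A B statistical_model_spaces(2)[OF Q \<rho>]
      by (subst emeasure_bind_prob_algebra[OF measurable_space[OF Qm \<rho>] measurable_joint_kernel[OF P]])
         (auto intro!: nn_integral_cong simp: rectangle)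
  qed
qed

lemma measurable_joint_kernel_subprob:
  assumes "statistical_model \<Theta> \<Omega> P" and "statistical_model \<Xi> \<Theta> Q" and "\<pi> \<in> space \<Xi>"
  shows "joint_kernel \<Theta> \<Omega> P \<in> Q \<pi> \<rightarrow>\<^sub>M subprob_algebra (\<Omega> \<Otimes>\<^sub>M \<Theta>)"
  using measurable_prob_algebraD[OF measurable_joint_kernel[OF assms(1)]]
    statistical_model_spaces(1)[OF assms(2,3)]
  by (simp cong: measurable_cong_sets)

lemma nn_integral_joint_model:
  assumes P: "statistical_model \<Theta> \<Omega> P" and Q: "statistical_model \<Xi> \<Theta> Q"
    and T: "joint_model \<Xi> \<Theta> \<Omega> P Q T" and \<pi>: "\<pi> \<in> space \<Xi>"
    and f: "f \<in> borel_measurable (\<Omega> \<Otimes>\<^sub>M \<Theta>)"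
  shows "(\<integral>\<^sup>+ z. f z \<partial>T \<pi>) = (\<integral>\<^sup>+ \<theta>. \<integral>\<^sup>+ \<omega>. f (\<omega>, \<theta>) \<partial>P \<theta> \<partial>Q \<pi>)"
  unfolding joint_model_eq_bind[OF P Q T \<pi>]
    nn_integral_bind[OF f measurable_joint_kernel_subprob[OF P Q \<pi>]]
  by (intro nn_integral_cong nn_integral_joint_kernel[OF P _ f])
     (simp add: statistical_model_spaces(2)[OF Q \<pi>])

lemma AE_joint_model:
  assumes P: "statistical_model \<Theta> \<Omega> P" and Q: "statistical_model \<Xi> \<Theta> Q"
    and T: "joint_model \<Xi> \<Theta> \<Omega> P Q T" and \<pi>: "\<pi> \<in> space \<Xi>"
    and R: "Measurable.pred (\<Omega> \<Otimes>\<^sub>M \<Theta>) R"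
  shows "(AE z in T \<pi>. R z) \<longleftrightarrow> (AE \<theta> in Q \<pi>. AE \<omega> in P \<theta>. R (\<omega>, \<theta>))"
  unfolding joint_model_eq_bind[OF P Q T \<pi>]
    AE_bind[OF measurable_joint_kernel_subprob[OF P Q \<pi>] R]
  by (intro AE_cong AE_joint_kernel[OF P _ R])
     (simp add: statistical_model_spaces(2)[OF Q \<pi>])

lemma borel_measurable_section:
  assumes "statistical_model \<Theta> \<Omega> P" and "\<theta> \<in> space \<Theta>"
    and f [measurable]: "f \<in> borel_measurable (\<Omega> \<Otimes>\<^sub>M \<Theta>)"
  shows "(\<lambda>\<omega>. f (\<omega>, \<theta>)) \<in> borel_measurable (P \<theta>)"
proof -
  have "(\<lambda>\<omega>. f (\<omega>, \<theta>)) \<in> borel_measurable \<Omega>"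
    using assms(2) by measurable
  then show ?thesis
    using statistical_model_spaces(1)[OF assms(1,2)] by (simp cong: measurable_cong_sets)
qed

lemma borel_measurable_conditional_integral:
  fixes f :: "'w \<times> 't \<Rightarrow> ennreal"
  assumes "statistical_model \<Theta> \<Omega> P" and f [measurable]: "f \<in> borel_measurable (\<Omega> \<Otimes>\<^sub>M \<Theta>)"
  shows "(\<lambda>\<theta>. \<integral>\<^sup>+ \<omega>. f (\<omega>, \<theta>) \<partial>P \<theta>) \<in> borel_measurable \<Theta>"
proof (rule nn_integral_measurable_subprob_algebra2)
  show "(\<lambda>(\<theta>, \<omega>). f (\<omega>, \<theta>)) \<in> borel_measurable (\<Theta> \<Otimes>\<^sub>M \<Omega>)"
    by measurable
  show "P \<in> \<Theta> \<rightarrow>\<^sub>M subprob_algebra \<Omega>"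
    using assms(1) by (simp add: statistical_model_def measurable_prob_algebraD)
qed

text \<open>The conventions \<open>0 / 0 = 0\<close> and \<open>\<infinity> / \<infinity> = 0\<close> make this bound hold without exception.\<close>

lemma ennreal_divide_self_le_one: "a / a \<le> (1 :: ennreal)"
proof (cases "a = 0 \<or> a = top")
  case True
  then show ?thesis by auto
next
  case False
  then show ?thesis by (simp add: less_top)
qed

text \<open>
  The only delicate case is a vanishing integral, where the right-hand side is \<open>0\<close>: then the
  nonnegative function \<open>f\<close> is almost everywhere \<open>0\<close> as well.
\<close>

lemma AE_eq_divide_times_integral:
  fixes f :: "'a \<Rightarrow> ennreal"
  assumes f: "f \<in> borel_measurable M" and finite: "(\<integral>\<^sup>+ x. f x \<partial>M) \<noteq> \<infinity>"
  shows "AE x in M. f x = f x / (\<integral>\<^sup>+ x. f x \<partial>M) * (\<integral>\<^sup>+ x. f x \<partial>M)"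
proof (cases "(\<integral>\<^sup>+ x. f x \<partial>M) = 0")
  case True
  then have "AE x in M. f x = 0"
    using f by (simp add: nn_integral_0_iff_AE)
  then show ?thesis
    by (rule AE_mp) (rule AE_I2, simp)
next
  case False
  then have "f x = f x / (\<integral>\<^sup>+ x. f x \<partial>M) * (\<integral>\<^sup>+ x. f x \<partial>M)" for x
    using finite by (simp add: ennreal_divide_times ennreal_divide_self less_top)
  then show ?thesis
    by (rule AE_I2)
qed

lemma e_product_subset_e_functions:
  assumes P: "statistical_model \<Theta> \<Omega> P" and Q: "statistical_model \<Xi> \<Theta> Q"
    and T: "joint_model \<Xi> \<Theta> \<Omega> P Q T"
  shows "e_product \<Xi> \<Theta> \<Omega> T (conditional_e_functions \<Theta> \<Omega> P) (e_functions \<Xi> \<Theta> Q)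
    \<subseteq> e_functions \<Xi> (\<Omega> \<Otimes>\<^sub>M \<Theta>) T"
proof
  fix f assume "f \<in> e_product \<Xi> \<Theta> \<Omega> T (conditional_e_functions \<Theta> \<Omega> P) (e_functions \<Xi> \<Theta> Q)"
  then obtain g h where f: "f \<in> borel_measurable (\<Omega> \<Otimes>\<^sub>M \<Theta>)"
    and g_mem: "g \<in> conditional_e_functions \<Theta> \<Omega> P" and h_mem: "h \<in> e_functions \<Xi> \<Theta> Q"
    and eq: "\<And>\<pi>. \<pi> \<in> space \<Xi> \<Longrightarrow> AE (\<omega>, \<theta>) in T \<pi>. f (\<omega>, \<theta>) = g (\<omega>, \<theta>) * h \<theta>"
    unfolding e_product_def by blast
  have g [measurable]: "g \<in> borel_measurable (\<Omega> \<Otimes>\<^sub>M \<Theta>)"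
    and g_le: "\<And>\<theta>. \<theta> \<in> space \<Theta> \<Longrightarrow> (\<integral>\<^sup>+ \<omega>. g (\<omega>, \<theta>) \<partial>P \<theta>) \<le> 1"
    using g_mem unfolding conditional_e_functions_def by blast+
  have h [measurable]: "h \<in> borel_measurable \<Theta>"
    and h_le: "\<And>\<pi>. \<pi> \<in> space \<Xi> \<Longrightarrow> (\<integral>\<^sup>+ \<theta>. h \<theta> \<partial>Q \<pi>) \<le> 1"
    using h_mem unfolding e_functions_def by blast+
  have "(\<integral>\<^sup>+ z. f z \<partial>T \<pi>) \<le> 1" if \<pi>: "\<pi> \<in> space \<Xi>" for \<pi>
  proof -
    have "(\<integral>\<^sup>+ z. f z \<partial>T \<pi>) = (\<integral>\<^sup>+ z. g z * h (snd z) \<partial>T \<pi>)"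
      using eq[OF \<pi>] by (intro nn_integral_cong_AE) (simp only: split_beta' prod.collapse)
    also have "\<dots> = (\<integral>\<^sup>+ \<theta>. \<integral>\<^sup>+ \<omega>. g (\<omega>, \<theta>) * h \<theta> \<partial>P \<theta> \<partial>Q \<pi>)"
      by (subst nn_integral_joint_model[OF P Q T \<pi>]) simp_all
    also have "\<dots> \<le> (\<integral>\<^sup>+ \<theta>. h \<theta> \<partial>Q \<pi>)"
    proof (rule nn_integral_mono)
      fix \<theta> assume "\<theta> \<in> space (Q \<pi>)"
      then have \<theta>: "\<theta> \<in> space \<Theta>"
        using statistical_model_spaces(2)[OF Q \<pi>] by simp
      have "(\<integral>\<^sup>+ \<omega>. g (\<omega>, \<theta>) * h \<theta> \<partial>P \<theta>) = (\<integral>\<^sup>+ \<omega>. g (\<omega>, \<theta>) \<partial>P \<theta>) * h \<theta>"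
        by (rule nn_integral_multc[OF borel_measurable_section[OF P \<theta> g]])
      also have "\<dots> \<le> h \<theta>"
        using mult_right_mono[OF g_le[OF \<theta>], of "h \<theta>"] by simp
      finally show "(\<integral>\<^sup>+ \<omega>. g (\<omega>, \<theta>) * h \<theta> \<partial>P \<theta>) \<le> h \<theta>" .
    qed
    also have "\<dots> \<le> 1"
      by (rule h_le[OF \<pi>])
    finally show ?thesis .
  qed
  with f show "f \<in> e_functions \<Xi> (\<Omega> \<Otimes>\<^sub>M \<Theta>) T"
    by (simp add: e_functions_def)
qed

text \<open>
  The factorization must not depend on \<open>\<pi>\<close>. The choice of \<open>h\<close> as the inner integral achieves
  this, because it involves \<open>P\<close> alone; \<open>\<pi>\<close> enters only through the null set where \<open>h\<close> is infinite.
\<close>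

lemma e_functions_subset_e_product:
  assumes P: "statistical_model \<Theta> \<Omega> P" and Q: "statistical_model \<Xi> \<Theta> Q"
    and T: "joint_model \<Xi> \<Theta> \<Omega> P Q T"
  shows "e_functions \<Xi> (\<Omega> \<Otimes>\<^sub>M \<Theta>) T
    \<subseteq> e_product \<Xi> \<Theta> \<Omega> T (conditional_e_functions \<Theta> \<Omega> P) (e_functions \<Xi> \<Theta> Q)"
proof
  fix f assume "f \<in> e_functions \<Xi> (\<Omega> \<Otimes>\<^sub>M \<Theta>) T"
  then have f [measurable]: "f \<in> borel_measurable (\<Omega> \<Otimes>\<^sub>M \<Theta>)"
    and f_le: "\<And>\<pi>. \<pi> \<in> space \<Xi> \<Longrightarrow> (\<integral>\<^sup>+ z. f z \<partial>T \<pi>) \<le> 1"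
    by (auto simp: e_functions_def)
  define h where "h \<theta> = (\<integral>\<^sup>+ \<omega>. f (\<omega>, \<theta>) \<partial>P \<theta>)" for \<theta>
  define g where "g z = f z / h (snd z)" for z
  have h [measurable]: "h \<in> borel_measurable \<Theta>"
    unfolding h_def by (rule borel_measurable_conditional_integral[OF P f])
  have g [measurable]: "g \<in> borel_measurable (\<Omega> \<Otimes>\<^sub>M \<Theta>)"
    unfolding g_def by measurable
  have h_le: "(\<integral>\<^sup>+ \<theta>. h \<theta> \<partial>Q \<pi>) \<le> 1" if "\<pi> \<in> space \<Xi>" for \<pi>
    using f_le[OF that] nn_integral_joint_model[OF P Q T that f] by (simp add: h_def)
  have g_le: "(\<integral>\<^sup>+ \<omega>. g (\<omega>, \<theta>) \<partial>P \<theta>) \<le> 1" if \<theta>: "\<theta> \<in> space \<Theta>" for \<theta>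
  proof -
    have "(\<integral>\<^sup>+ \<omega>. g (\<omega>, \<theta>) \<partial>P \<theta>) = h \<theta> / h \<theta>"
      using nn_integral_divide[OF borel_measurable_section[OF P \<theta> f], of "h \<theta>"]
      by (simp add: g_def h_def)
    then show ?thesis
      using ennreal_divide_self_le_one by simp
  qed
  have "AE z in T \<pi>. f z = g z * h (snd z)" if \<pi>: "\<pi> \<in> space \<Xi>" for \<pi>
  proof -
    have "h \<in> borel_measurable (Q \<pi>)"
      using h statistical_model_spaces(1)[OF Q \<pi>] by (simp cong: measurable_cong_sets)
    moreover have "(\<integral>\<^sup>+ \<theta>. h \<theta> \<partial>Q \<pi>) \<noteq> \<infinity>"
      using h_le[OF \<pi>] by (auto simp: top_unique)
    ultimately have finite: "AE \<theta> in Q \<pi>. h \<theta> \<noteq> \<infinity>"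
      by (rule nn_integral_PInf_AE)
    have fiber: "AE \<omega> in P \<theta>. f (\<omega>, \<theta>) = g (\<omega>, \<theta>) * h \<theta>"
      if "\<theta> \<in> space (Q \<pi>)" "h \<theta> \<noteq> \<infinity>" for \<theta>
      using that statistical_model_spaces(2)[OF Q \<pi>]
        AE_eq_divide_times_integral[OF borel_measurable_section[OF P _ f], of \<theta>]
      by (simp add: g_def h_def)
    have "AE \<theta> in Q \<pi>. AE \<omega> in P \<theta>. f (\<omega>, \<theta>) = g (\<omega>, \<theta>) * h \<theta>"
      using finite by (rule AE_mp) (intro AE_I2 impI fiber)
    then show ?thesis
      by (subst AE_joint_model[OF P Q T \<pi>]) simp_all
  qed
  then have "\<forall>\<pi>\<in>space \<Xi>. AE (\<omega>, \<theta>) in T \<pi>. f (\<omega>, \<theta>) = g (\<omega>, \<theta>) * h \<theta>"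
    by (simp add: case_prod_beta)
  moreover have "g \<in> conditional_e_functions \<Theta> \<Omega> P"
    using g_le by (simp add: conditional_e_functions_def)
  moreover have "h \<in> e_functions \<Xi> \<Theta> Q"
    using h_le by (simp add: e_functions_def)
  ultimately show "f \<in> e_product \<Xi> \<Theta> \<Omega> T (conditional_e_functions \<Theta> \<Omega> P) (e_functions \<Xi> \<Theta> Q)"
    using f unfolding e_product_def by blast
qed

theorem theorem14:
  fixes \<Omega> :: "'w measure" and \<Theta> :: "'t measure" and \<Xi> :: "'p measure"
    and P :: "'t \<Rightarrow> 'w measure" and Q :: "'p \<Rightarrow> 't measure" and T :: "'p \<Rightarrow> ('w \<times> 't) measure"
  assumes "statistical_model \<Theta> \<Omega> P"
    and "statistical_model \<Xi> \<Theta> Q"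
    and "joint_model \<Xi> \<Theta> \<Omega> P Q T"
  shows "e_functions \<Xi> (\<Omega> \<Otimes>\<^sub>M \<Theta>) T =
    e_product \<Xi> \<Theta> \<Omega> T (conditional_e_functions \<Theta> \<Omega> P) (e_functions \<Xi> \<Theta> Q)"
  using e_functions_subset_e_product[OF assms] e_product_subset_e_functions[OF assms]
  by (rule subset_antisym)

end
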